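(* Let $R$ be a $\mathbb{Q}$-domain with field of fractions $K$, $n=2$, and let $D\in\mathrm{LND}_R R[x_1,x_2]$ be such that $\exp D\in\mathrm{T}(R,\mathbf{x})$. Then there exists $\tau\in\mathrm{T}(R,\mathbf{x})$ such that $\tau^{-1}\circ D\circ\tau$ is triangular or affine. If $V(R)=K^\times$, then there exists $\tau\in\mathrm{T}(R,\mathbf{x})$ such that $\tau^{-1}\circ D\circ\tau$ is triangular.
   Context: $\mathrm{LND}_R R[\mathbf{x}]$ is the set of $R$-derivations $D$ with $D^l(f)=0$ for some $l$ depending on $f$; $\exp D(f)=\sum_{l\ge0}D^l(f)/l!$. $\mathrm{T}(R,\mathbf{x})$ is the subgroup of $\mathrm{Aut}(R[\mathbf{x}]/R)$ generated by affine automorphisms ($\deg\phi(x_i)=1$ for all $i$) and elementary automorphisms (fixing all variables but one). A derivation $D$ is triangular if $D(x_i)\in R[x_1,\dots,x_{i-1}]$ for all $i$, and affine if $\deg D(x_i)\le1$ for all $i$. $V(R)$ is the set of $\alpha/\beta\in K^\times$ with $\alpha,\beta\in R\setminus\{0\}$, $\alpha R+\beta R=R$. *)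

theory Defs
  imports "HOL-Computational_Algebra.Polynomial" "HOL-Computational_Algebra.Fraction_Field"
begin

text \<open>R[x1,x2] is modelled as ('a poly) poly: polynomials in x2 whose coefficients
are polynomials in x1 over R.\<close>

definition const2 :: "'a::comm_ring_1 \<Rightarrow> 'a poly poly" where
  "const2 r = [:[:r:]:]"

definition X1 :: "'a::comm_ring_1 poly poly" where
  "X1 = [:[:0, 1:]:]"

definition X2 :: "'a::comm_ring_1 poly poly" where
  "X2 = [:0, 1:]"

definition tdeg :: "'a::comm_ring_1 poly poly \<Rightarrow> nat" where
  "tdeg f = (if f = 0 then 0 else Max {degree (coeff f i) + i | i. coeff f i \<noteq> 0})"

definition Q_domain :: "'a::idom itself \<Rightarrow> bool" where
  "Q_domain _ \<longleftrightarrow> (\<forall>n::nat. n > 0 \<longrightarrow> (of_nat n :: 'a) dvd 1)"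

definition is_R_derivation :: "('a::comm_ring_1 poly poly \<Rightarrow> 'a poly poly) \<Rightarrow> bool" where
  "is_R_derivation D \<longleftrightarrow>
     (\<forall>f g. D (f + g) = D f + D g) \<and>
     (\<forall>f g. D (f * g) = f * D g + g * D f) \<and>
     (\<forall>r. D (const2 r) = 0)"

definition LND :: "('a::comm_ring_1 poly poly \<Rightarrow> 'a poly poly) set" where
  "LND = {D. is_R_derivation D \<and> (\<forall>f. \<exists>l. (D ^^ l) f = 0)}"

definition nat_inv :: "nat \<Rightarrow> 'a::idom" where
  "nat_inv n = (THE u. of_nat n * u = 1)"

definition exp_der :: "('a::idom poly poly \<Rightarrow> 'a poly poly) \<Rightarrow> 'a poly poly \<Rightarrow> 'a poly poly" where
  "exp_der D f = (\<Sum>l < (LEAST m. (D ^^ m) f = 0). const2 (nat_inv (fact l)) * (D ^^ l) f)"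

definition is_R_aut :: "('a::comm_ring_1 poly poly \<Rightarrow> 'a poly poly) \<Rightarrow> bool" where
  "is_R_aut \<phi> \<longleftrightarrow> bij \<phi> \<and>
     (\<forall>f g. \<phi> (f + g) = \<phi> f + \<phi> g) \<and>
     (\<forall>f g. \<phi> (f * g) = \<phi> f * \<phi> g) \<and>
     \<phi> 1 = 1 \<and> (\<forall>r. \<phi> (const2 r) = const2 r)"

definition is_affine_aut :: "('a::comm_ring_1 poly poly \<Rightarrow> 'a poly poly) \<Rightarrow> bool" where
  "is_affine_aut \<phi> \<longleftrightarrow> is_R_aut \<phi> \<and> tdeg (\<phi> X1) = 1 \<and> tdeg (\<phi> X2) = 1"

definition is_elementary_aut :: "('a::comm_ring_1 poly poly \<Rightarrow> 'a poly poly) \<Rightarrow> bool" where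
  "is_elementary_aut \<phi> \<longleftrightarrow> is_R_aut \<phi> \<and> (\<phi> X1 = X1 \<or> \<phi> X2 = X2)"

inductive_set Tame :: "('a::comm_ring_1 poly poly \<Rightarrow> 'a poly poly) set" where
  tame_id: "id \<in> Tame"
| tame_affine: "is_affine_aut \<phi> \<Longrightarrow> \<phi> \<in> Tame"
| tame_elem: "is_elementary_aut \<phi> \<Longrightarrow> \<phi> \<in> Tame"
| tame_comp: "\<phi> \<in> Tame \<Longrightarrow> \<psi> \<in> Tame \<Longrightarrow> \<phi> \<circ> \<psi> \<in> Tame"
| tame_inv: "\<phi> \<in> Tame \<Longrightarrow> inv \<phi> \<in> Tame"

definition is_triangular :: "('a::comm_ring_1 poly poly \<Rightarrow> 'a poly poly) \<Rightarrow> bool" where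
  "is_triangular D \<longleftrightarrow> (\<exists>r. D X1 = const2 r) \<and> degree (D X2) = 0"

definition is_affine_der :: "('a::comm_ring_1 poly poly \<Rightarrow> 'a poly poly) \<Rightarrow> bool" where
  "is_affine_der D \<longleftrightarrow> tdeg (D X1) \<le> 1 \<and> tdeg (D X2) \<le> 1"

definition V_set :: "'a::idom fract set" where
  "V_set = {Fract \<alpha> \<beta> | \<alpha> \<beta>. \<alpha> \<noteq> 0 \<and> \<beta> \<noteq> 0 \<and> (\<exists>u v. u * \<alpha> + v * \<beta> = 1)}"

end

(*
  Every tame automorphism is a product of affine and triangular ones. Conjugating by factors and
  merging neighbours, exp D becomes either affine, or triangular, or a word alternating strictly
  between affine non-triangular and triangular non-affine factors. In the last case the x2-degrees of
  the powers of exp D grow without bound; but the iterates (exp D)^m (x2) all lie in the span of the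
  finitely many nonzero D^l(x2), so this case is impossible.

  A submodule stable under exp D is stable under D, because D is recovered from exp D - 1 by
  downward induction on the nilpotency order. Hence D is affine or triangular when exp D is.

  For an affine D, the last iterate of x1 that is not constant is a form u x1 + v x2 + w whose image
  under D is constant. If V(R) is everything, (u, v) is proportional to a unimodular vector, which is
  the first row of a linear automorphism making D triangular.
*)
theory Submission
  imports Defs
begin

section \<open>Constants, affine forms and total degree\<close>

lemma const2_simps [simp]:
  "const2 0 = (0 :: 'a::comm_ring_1 poly poly)"
  "const2 1 = (1 :: 'a::comm_ring_1 poly poly)"
  "const2 (r + s) = const2 r + const2 s"
  "const2 (r - s) = const2 r - const2 s"
  "const2 (- r) = - const2 r"
  "const2 (r * s) = const2 r * const2 s"
  "coeff (const2 r * f) i = smult r (coeff f i)"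
  by (simp_all add: const2_def one_pCons mult.commute)

lemma const2_eq_0_iff [simp]: "const2 r = 0 \<longleftrightarrow> r = 0"
  by (simp add: const2_def)

lemma degree_const2 [simp]: "degree (const2 r) = 0"
  by (simp add: const2_def)

lemma degree_const2_mult [simp]:
  "degree (const2 r * f) = (if r = 0 then 0 else degree f)" for r :: "'a::idom"
  by (cases "f = 0") (auto simp: degree_mult_eq)

lemma degree_X1 [simp]: "degree X1 = 0" and degree_X2 [simp]: "degree X2 = 1"
  by (simp_all add: X1_def X2_def)

text \<open>The form \<open>a * x1 + b * x2 + c\<close>; \<open>tdeg_le_1_iff\<close> shows that
  these are exactly the polynomials of total degree at most 1.\<close>

definition lin :: "'a::comm_ring_1 \<Rightarrow> 'a \<Rightarrow> 'a \<Rightarrow> 'a poly poly" where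
  "lin a b c = [:[:c, a:], [:b:]:]"

lemma lin_altdef: "lin a b c = const2 a * X1 + const2 b * X2 + const2 c"
  by (simp add: lin_def const2_def X1_def X2_def)

lemma lin_eq_iff [simp]: "lin a b c = lin a' b' c' \<longleftrightarrow> a = a' \<and> b = b' \<and> c = c'"
  by (auto simp: lin_def)

lemma lin_special: "X1 = lin 1 0 0" "X2 = lin 0 1 0" "const2 r = lin 0 0 r"
    "0 = lin 0 0 (0::'a::comm_ring_1)"
  by (simp_all add: lin_def X1_def X2_def const2_def one_pCons)

lemma lin_arith:
  "lin a b c + lin a' b' c' = lin (a + a') (b + b') (c + c')"
  "const2 r * lin a b c = lin (r * a) (r * b) (r * c)"
  "lin a b c + const2 r = lin a b (c + r)"
  by (simp_all add: lin_def const2_def)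

lemma degree_lin_eq_0_iff: "degree (lin a b c) = 0 \<longleftrightarrow> b = 0"
  by (simp add: lin_def)

lemma tdeg_le_iff: "tdeg f \<le> n \<longleftrightarrow> (\<forall>i. coeff f i \<noteq> 0 \<longrightarrow> degree (coeff f i) + i \<le> n)"
proof (cases "f = 0")
  case False
  let ?S = "{degree (coeff f i) + i | i. coeff f i \<noteq> 0}"
  have "?S \<subseteq> (\<lambda>i. degree (coeff f i) + i) ` {..degree f}"
    by (auto intro: le_degree)
  then have "finite ?S" by (rule finite_subset) simp
  moreover have "?S \<noteq> {}" using False leading_coeff_neq_0 by blast
  ultimately show ?thesis using False by (auto simp: tdeg_def Max_le_iff)
qed (simp add: tdeg_def)

lemma tdeg_le_1_iff: "tdeg f \<le> 1 \<longleftrightarrow> (\<exists>a b c. f = lin a b c)"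
proof
  assume "tdeg f \<le> 1"
  then have *: "degree (coeff f i) + i \<le> 1" if "coeff f i \<noteq> 0" for i
    using that by (simp add: tdeg_le_iff)
  have "f = lin (coeff (coeff f 0) 1) (coeff (coeff f 1) 0) (coeff (coeff f 0) 0)"
  proof (intro poly_eqI)
    fix i j
    have "coeff (coeff f i) j = 0" if "i + j > 1"
      using *[of i] that by (cases "coeff f i = 0") (auto intro!: coeff_eq_0)
    then show "coeff (coeff f i) j
        = coeff (coeff (lin (coeff (coeff f 0) 1) (coeff (coeff f 1) 0) (coeff (coeff f 0) 0)) i) j"
      by (auto simp: lin_def coeff_pCons split: nat.split)
  qed
  then show "\<exists>a b c. f = lin a b c" by blast
next
  assume "\<exists>a b c. f = lin a b c"
  then show "tdeg f \<le> 1"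
    by (auto simp: tdeg_le_iff lin_def coeff_pCons split: nat.splits)
qed

lemma tdeg_lin: "tdeg (lin a b c) = (if a = 0 \<and> b = 0 then 0 else 1)"
proof -
  have "tdeg (lin a b c) \<le> 1" using tdeg_le_1_iff by blast
  moreover have "tdeg (lin a b c) \<le> 0 \<longleftrightarrow> a = 0 \<and> b = 0"
    unfolding tdeg_le_iff by (auto simp: lin_def coeff_pCons split: nat.splits)
  ultimately show ?thesis by (auto simp: le_Suc_eq)
qed

text \<open>Allows degree bounds to be proved after multiplication by a nonzero constant, such as a
  determinant.\<close>

lemma tdeg_const2_mult:
  fixes f :: "'a::idom poly poly"
  assumes "r \<noteq> 0"
  shows "tdeg (const2 r * f) \<le> n \<longleftrightarrow> tdeg f \<le> n"
  using assms by (simp add: tdeg_le_iff)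

section \<open>Endomorphisms and automorphisms over R\<close>

definition is_R_hom :: "('a::comm_ring_1 poly poly \<Rightarrow> 'a poly poly) \<Rightarrow> bool" where
  "is_R_hom \<phi> \<longleftrightarrow> (\<forall>f g. \<phi> (f + g) = \<phi> f + \<phi> g) \<and>
     (\<forall>f g. \<phi> (f * g) = \<phi> f * \<phi> g) \<and> (\<forall>r. \<phi> (const2 r) = const2 r)"

text \<open>Preservation of 1 is the case r = 1 of fixing constants.\<close>

lemma is_R_aut_iff: "is_R_aut \<phi> \<longleftrightarrow> bij \<phi> \<and> is_R_hom \<phi>"
  unfolding is_R_aut_def is_R_hom_def by (metis const2_simps(2))

lemma is_R_aut_bij: "is_R_aut \<phi> \<Longrightarrow> bij \<phi>"
  by (simp add: is_R_aut_iff)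

lemma is_R_aut_hom: "is_R_aut \<phi> \<Longrightarrow> is_R_hom \<phi>"
  by (simp add: is_R_aut_iff)

lemma R_hom_simps:
  assumes "is_R_hom \<phi>"
  shows "\<phi> (f + g) = \<phi> f + \<phi> g" "\<phi> (f * g) = \<phi> f * \<phi> g" "\<phi> (const2 r) = const2 r"
    "\<phi> 0 = 0" "\<phi> (lin a b c) = const2 a * \<phi> X1 + const2 b * \<phi> X2 + const2 c"
proof -
  show *: "\<phi> (f + g) = \<phi> f + \<phi> g" "\<phi> (f * g) = \<phi> f * \<phi> g" "\<phi> (const2 r) = const2 r" for f g r
    using assms by (auto simp: is_R_hom_def)
  show "\<phi> 0 = 0" using *(3)[of 0] by simp
  show "\<phi> (lin a b c) = const2 a * \<phi> X1 + const2 b * \<phi> X2 + const2 c"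
    by (simp add: lin_altdef *)
qed

lemma pCons_outer: "pCons p f = [:p:] + X2 * f"
  by (simp add: X2_def)

lemma pCons_inner: "[:pCons c p:] = const2 c + X1 * [:p:]"
  by (simp add: X1_def const2_def)

text \<open>Two nested Horner inductions, first over polynomials in x1, then over polynomials in
  x2.\<close>

lemma R_hom_eqI:
  assumes "is_R_hom \<phi>" "is_R_hom \<psi>" "\<phi> X1 = \<psi> X1" "\<phi> X2 = \<psi> X2"
  shows "\<phi> = \<psi>"
proof
  have inner: "\<phi> [:p:] = \<psi> [:p:]" for p
  proof (induction p)
    case 0
    then show ?case using R_hom_simps(4)[OF assms(1)] R_hom_simps(4)[OF assms(2)] by simp
  next
    case (pCons c p)
    then show ?case
      unfolding pCons_inner
      by (simp add: assms R_hom_simps(1-3)[OF assms(1)] R_hom_simps(1-3)[OF assms(2)] del: mult_pCons_right)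
  qed
  fix f
  show "\<phi> f = \<psi> f"
  proof (induction f)
    case 0
    then show ?case using R_hom_simps(4)[OF assms(1)] R_hom_simps(4)[OF assms(2)] by simp
  next
    case (pCons p f)
    then show ?case
      unfolding pCons_outer[of p f]
      by (simp add: inner assms R_hom_simps(1-3)[OF assms(1)] R_hom_simps(1-3)[OF assms(2)])
  qed
qed

lemma R_hom_id: "is_R_hom id"
  by (simp add: is_R_hom_def)

lemma R_hom_comp: "is_R_hom \<phi> \<Longrightarrow> is_R_hom \<psi> \<Longrightarrow> is_R_hom (\<phi> \<circ> \<psi>)"
  by (simp add: is_R_hom_def)

lemma is_R_aut_id: "is_R_aut id"
  by (simp add: is_R_aut_iff R_hom_id)

lemma is_R_aut_comp: "is_R_aut \<phi> \<Longrightarrow> is_R_aut \<psi> \<Longrightarrow> is_R_aut (\<phi> \<circ> \<psi>)"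
  by (simp add: is_R_aut_iff R_hom_comp bij_comp)

lemma is_R_aut_inverse:
  assumes "is_R_aut \<phi>"
  shows "\<phi> (inv \<phi> f) = f" "inv \<phi> (\<phi> f) = f"
  using assms by (auto simp: is_R_aut_iff bij_def fun_eq_iff surj_f_inv_f)

lemma is_R_aut_inv:
  assumes "is_R_aut \<phi>"
  shows "is_R_aut (inv \<phi>)"
proof -
  note hom = R_hom_simps[OF is_R_aut_hom[OF assms]]
  have *: "inv \<phi> f = g \<longleftrightarrow> f = \<phi> g" for f g
    using is_R_aut_inverse[OF assms] by metis
  show ?thesis
    unfolding is_R_aut_iff is_R_hom_def
    using assms by (auto simp: is_R_aut_iff bij_imp_bij_inv * hom is_R_aut_inverse[OF assms])
qed

lemma Tame_aut: "\<phi> \<in> Tame \<Longrightarrow> is_R_aut \<phi>"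
  by (induction rule: Tame.induct)
    (simp_all only: is_R_aut_id is_R_aut_comp is_R_aut_inv is_affine_aut_def is_elementary_aut_def)

text \<open>Evaluation at \<open>x\<close> along a coefficient homomorphism. It is kept generic
  because \<open>R_hom_exists\<close> uses it twice: along \<open>const2\<close> for x1, then along
  the resulting map \<open>h\<close> for x2.\<close>

lemma poly_map_poly_hom:
  fixes h :: "'b::comm_ring_1 \<Rightarrow> 'c::comm_ring_1"
  assumes h: "\<And>x y. h (x + y) = h x + h y" "\<And>x y. h (x * y) = h x * h y"
  defines "g \<equiv> (\<lambda>p x. poly (map_poly h p) x)"
  shows "g (p + q) x = g p x + g q x" "g (p * q) x = g p x * g q x"
    "g (pCons c p) x = h c + x * g p x"
proof -
  have h0: "h 0 = 0" using h(1)[of 0 0] by simp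
  show pCons: "g (pCons c p) x = h c + x * g p x" for c p
    by (simp add: g_def map_poly_pCons h0)
  have g0: "g 0 x = 0" by (simp add: g_def)
  show add: "g (p + q) x = g p x + g q x" for p q
    by (induction p q rule: poly_induct2) (simp_all add: g0 pCons h algebra_simps)
  have smult: "g (smult c q) x = h c * g q x" for c q
    by (induction q) (simp_all add: g0 pCons h algebra_simps)
  show "g (p * q) x = g p x * g q x"
    by (induction p) (simp_all add: g0 pCons add smult h0 algebra_simps)
qed

lemma R_hom_exists: "\<exists>\<phi>. is_R_hom \<phi> \<and> \<phi> X1 = F \<and> \<phi> X2 = G"
proof -
  define h where "h p = poly (map_poly const2 p) F" for p
  note h = poly_map_poly_hom[of const2, simplified, where x = F, folded h_def]
  note \<phi> = poly_map_poly_hom[of h, OF h(1,2)]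
  have [simp]: "h 0 = 0" by (simp add: h_def)
  have "h 1 = 1" using h(3)[of 1 0] by (simp add: one_pCons)
  then have "is_R_hom (\<lambda>f. poly (map_poly h f) G)"
    unfolding is_R_hom_def by (auto simp: \<phi>(1,2)) (simp add: const2_def[of r for r] \<phi>(3) h(3))
  moreover have "poly (map_poly h X1) G = F" "poly (map_poly h X2) G = G"
    using \<open>h 1 = 1\<close> by (simp_all add: X1_def X2_def \<phi>(3) h(3))
  ultimately show ?thesis by blast
qed

text \<open>As the determinant is 1, the adjugate matrix defines the inverse
  \<open>\<psi>\<close>.\<close>

lemma linear_aut_exists:
  assumes "a * d - b * c = (1 :: 'a::comm_ring_1)"
  shows "\<exists>\<phi>\<in>Tame. \<phi> X1 = lin a b 0 \<and> \<phi> X2 = lin c d 0"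
proof -
  obtain \<phi> where \<phi>: "is_R_hom \<phi>" "\<phi> X1 = lin a b 0" "\<phi> X2 = lin c d 0"
    using R_hom_exists by blast
  obtain \<psi> where \<psi>: "is_R_hom \<psi>" "\<psi> X1 = lin d (-b) 0" "\<psi> X2 = lin (-c) a 0"
    using R_hom_exists by blast
  have det: "a * d = 1 + b * c" using assms by (simp add: algebra_simps)
  have "\<phi> \<circ> \<psi> = id" "\<psi> \<circ> \<phi> = id"
    by (rule R_hom_eqI,
        simp_all add: R_hom_comp \<phi> \<psi> R_hom_id R_hom_simps(5)[OF \<phi>(1)] R_hom_simps(5)[OF \<psi>(1)],
        simp_all add: lin_arith lin_special(1,2) lin_special(4)[symmetric] det mult.commute algebra_simps)+
  then have "bij \<phi>" using o_bij by blast
  moreover have "\<not> (a = 0 \<and> b = 0)" "\<not> (c = 0 \<and> d = 0)"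
    using assms by auto
  ultimately have "is_affine_aut \<phi>"
    by (auto simp: is_affine_aut_def is_R_aut_iff \<phi> tdeg_lin)
  then show ?thesis using \<phi> tame_affine by blast
qed

section \<open>Triangular and affine automorphisms\<close>

lemma R_hom_inner:
  assumes "is_R_hom \<phi>" "\<phi> X1 = [:q:]"
  shows "\<phi> [:p:] = [:pcompose p q:]"
proof (induction p)
  case 0
  then show ?case using R_hom_simps(4)[OF assms(1)] by simp
next
  case (pCons c p)
  then show ?case
    unfolding pCons_inner
    by (simp add: assms(2) R_hom_simps(1-3)[OF assms(1)] pcompose_pCons del: mult_pCons_right)
      (simp add: const2_def)
qed

text \<open>If x1 stays in R[x1], then \<open>\<phi>\<close> multiplies x2-degrees by the degree of
  \<open>\<phi> X2\<close>. That factor is positive, as otherwise the image would lie in R[x1];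
  applied to a preimage of x2, the formula forces it to be 1.\<close>

lemma R_aut_degree:
  fixes \<phi> :: "'a::idom poly poly \<Rightarrow> 'a poly poly"
  assumes \<phi>: "is_R_aut \<phi>" and X1: "degree (\<phi> X1) = 0"
  shows "degree (\<phi> f) = degree f"
proof -
  note hom = R_hom_simps[OF is_R_aut_hom[OF \<phi>]]
  obtain q where q: "\<phi> X1 = [:q:]" using X1 by (rule degree_eq_zeroE)
  note inner = R_hom_inner[OF is_R_aut_hom[OF \<phi>] q]
  have nz: "\<phi> f \<noteq> 0" if "f \<noteq> 0" for f
    using that \<phi> hom(4) by (metis is_R_aut_inverse(2))
  obtain g where g: "\<phi> g = X2" using is_R_aut_inverse(1)[OF \<phi>] by blast
  have d: "degree (\<phi> X2) > 0"
  proof (rule ccontr)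
    assume "\<not> degree (\<phi> X2) > 0"
    then have "degree (\<phi> f) = 0" for f
    proof (induction f)
      case (pCons p f)
      have "degree (\<phi> X2 * \<phi> f) = 0"
        using pCons degree_mult_le[of "\<phi> X2" "\<phi> f"] by simp
      then show ?case
        unfolding pCons_outer[of p f] using degree_add_le[of "\<phi> [:p:]" 0 "\<phi> X2 * \<phi> f"]
        by (simp add: hom inner)
    qed (simp add: hom)
    from this[of g] show False by (simp add: g)
  qed
  have *: "degree (\<phi> f) = degree f * degree (\<phi> X2)" for f
  proof (induction f)
    case (pCons p f)
    show ?case
    proof (cases "f = 0")
      case False
      then have "degree (\<phi> X2 * \<phi> f) = degree (\<phi> X2) + degree f * degree (\<phi> X2)"
        using pCons.IH nz[of f] nz[of X2] by (subst degree_mult_eq) (auto simp: X2_def)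
      then show ?thesis
        using False d by (subst pCons_outer) (simp add: hom inner degree_add_eq_right)
    qed (simp add: inner)
  qed (simp add: hom)
  from *[of g] have "degree (\<phi> X2) = 1" by (simp add: g)
  with * show ?thesis by simp
qed

text \<open>Triangular automorphisms are exactly those preserving the degree in x2, affine ones exactly those
  preserving the polynomials of total degree at most 1; with these definitions closure under
  composition and inverses is immediate.\<close>

definition tri :: "('a::idom poly poly \<Rightarrow> 'a poly poly) set" where
  "tri = {\<phi> \<in> Tame. \<forall>f. degree (\<phi> f) = degree f}"

definition aff :: "('a::idom poly poly \<Rightarrow> 'a poly poly) set" where
  "aff = {\<phi> \<in> Tame. \<forall>f. tdeg (\<phi> f) \<le> 1 \<longleftrightarrow> tdeg f \<le> 1}"

lemma triI: "\<phi> \<in> Tame \<Longrightarrow> degree (\<phi> X1) = 0 \<Longrightarrow> \<phi> \<in> tri"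
  by (simp add: tri_def R_aut_degree Tame_aut)

text \<open>The equivalence in \<open>aff\<close> also requires the inverse to be affine; this is
  what has to be derived from the images of x1 and x2.\<close>

lemma affI:
  assumes \<phi>: "\<phi> \<in> Tame" and le: "tdeg (\<phi> X1) \<le> 1" "tdeg (\<phi> X2) \<le> 1"
  shows "\<phi> \<in> aff"
proof -
  note aut = Tame_aut[OF \<phi>]
  note hom = R_hom_simps[OF is_R_aut_hom[OF aut]]
  note inv = R_hom_simps[OF is_R_aut_hom[OF is_R_aut_inv[OF aut]]]
  have inj: "f = g" if "\<phi> f = \<phi> g" for f g
    using that aut by (metis is_R_aut_inverse(2))
  obtain a b e where 1: "\<phi> X1 = lin a b e" using le unfolding tdeg_le_1_iff by blast
  obtain c d e' where 2: "\<phi> X2 = lin c d e'" using le unfolding tdeg_le_1_iff by blast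
  define \<Delta> where "\<Delta> = a * d - b * c"
  \<comment> \<open>The rows of the adjugate matrix, with constant terms chosen to cancel
    \<open>e\<close> and \<open>e'\<close>.\<close>
  have adj1: "\<phi> (lin d (-b) (b * e' - d * e)) = const2 \<Delta> * X1"
    and adj2: "\<phi> (lin (-c) a (c * e - a * e')) = const2 \<Delta> * X2"
    by (simp_all only: hom(5) 1 2, simp_all only: lin_special(1,2) lin_arith \<Delta>_def)
      (simp_all add: algebra_simps)
  have "\<Delta> \<noteq> 0"
  proof
    \<comment> \<open>Both adjugate forms then vanish by injectivity, so \<open>a = b = 0\<close>
      and \<open>\<phi> X1\<close> would be constant.\<close>
    assume "\<Delta> = 0"
    then have "lin d (-b) (b * e' - d * e) = 0" "lin (-c) a (c * e - a * e') = 0"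
      using adj1 adj2 by (metis inj hom(4) const2_simps(1) mult_zero_left)+
    then have "a = 0" "b = 0" by (simp_all add: lin_special)
    then have "\<phi> X1 = \<phi> (const2 e)" using 1 unfolding hom(3) by (simp add: lin_special(3))
    then have "X1 = const2 e" by (rule inj)
    then show False by (simp add: lin_special)
  qed
  \<comment> \<open>The inverse is affine after clearing the determinant, without knowing that it is a unit.\<close>
  have "const2 \<Delta> * inv \<phi> X1 = lin d (-b) (b * e' - d * e)"
    "const2 \<Delta> * inv \<phi> X2 = lin (-c) a (c * e - a * e')"
    by (rule inj, simp add: adj1 adj2 hom(2,3) is_R_aut_inverse(1)[OF aut])+
  then have "tdeg (const2 \<Delta> * inv \<phi> X1) \<le> 1" "tdeg (const2 \<Delta> * inv \<phi> X2) \<le> 1"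
    by (metis tdeg_le_1_iff)+
  then have "tdeg (inv \<phi> X1) \<le> 1" "tdeg (inv \<phi> X2) \<le> 1"
    using tdeg_const2_mult[OF \<open>\<Delta> \<noteq> 0\<close>, of _ 1] by blast+
  then obtain a1 b1 c1 a2 b2 c2 where 3: "inv \<phi> X1 = lin a1 b1 c1" "inv \<phi> X2 = lin a2 b2 c2"
    unfolding tdeg_le_1_iff by blast
  have fwd: "tdeg (\<phi> f) \<le> 1" if "tdeg f \<le> 1" for f
    using that unfolding tdeg_le_1_iff by (auto simp: hom 1 2 lin_arith)
  have bwd: "tdeg (inv \<phi> f) \<le> 1" if "tdeg f \<le> 1" for f
    using that unfolding tdeg_le_1_iff by (auto simp: inv 3 lin_arith)
  have "tdeg (\<phi> f) \<le> 1 \<longleftrightarrow> tdeg f \<le> 1" for f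
    using fwd[of f] bwd[of "\<phi> f"] unfolding is_R_aut_inverse(2)[OF aut] by blast
  then show ?thesis using \<phi> by (simp add: aff_def)
qed

lemma tri_Tame: "\<phi> \<in> tri \<Longrightarrow> \<phi> \<in> Tame" and aff_Tame: "\<phi> \<in> aff \<Longrightarrow> \<phi> \<in> Tame"
  by (simp_all add: tri_def aff_def)

lemma tri_aff_id: "id \<in> tri" "id \<in> aff"
  by (simp_all add: tri_def aff_def tame_id)

lemma tri_comp: "\<phi> \<in> tri \<Longrightarrow> \<psi> \<in> tri \<Longrightarrow> \<phi> \<circ> \<psi> \<in> tri"
  by (simp add: tri_def tame_comp)

lemma aff_comp: "\<phi> \<in> aff \<Longrightarrow> \<psi> \<in> aff \<Longrightarrow> \<phi> \<circ> \<psi> \<in> aff"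
  by (simp add: aff_def tame_comp)

lemma tri_inv:
  assumes "\<phi> \<in> tri"
  shows "inv \<phi> \<in> tri"
proof -
  have "degree (\<phi> f) = degree f" for f
    using assms by (simp add: tri_def)
  from this[of "inv \<phi> f" for f] show ?thesis
    using assms by (simp add: tri_def tame_inv Tame_aut is_R_aut_inverse(1))
qed

lemma aff_inv:
  assumes "\<phi> \<in> aff"
  shows "inv \<phi> \<in> aff"
proof -
  have "tdeg (\<phi> f) \<le> 1 \<longleftrightarrow> tdeg f \<le> 1" for f
    using assms by (simp add: aff_def)
  from this[of "inv \<phi> f" for f] show ?thesis
    using assms by (simp add: aff_def tame_inv Tame_aut is_R_aut_inverse(1))
qed

lemma aff_X:
  assumes "a \<in> aff"
  obtains a1 b1 c1 a2 b2 c2 where "a X1 = lin a1 b1 c1" "a X2 = lin a2 b2 c2"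
proof -
  have "tdeg (a X1) \<le> 1" "tdeg (a X2) \<le> 1"
    using assms by (simp_all add: aff_def lin_special(1,2) tdeg_lin)
  then show ?thesis unfolding tdeg_le_1_iff using that by blast
qed

text \<open>The inverse preserves x2-degrees too. On R[x1] it composes with \<open>e\<close> to the
  identity, so \<open>q\<close> has degree 1; comparing coefficients of x2 makes \<open>s\<close> a
  divisor of 1, hence constant.\<close>

lemma tri_X:
  assumes "e \<in> tri"
  obtains a b c p where "e X1 = lin a 0 b" "a \<noteq> 0" "e X2 = [:p, [:c:]:]"
proof -
  have aut: "is_R_aut e" and deg: "degree (e f) = degree f" for f
    using assms by (auto simp: tri_def Tame_aut)
  note hom = R_hom_simps[OF is_R_aut_hom[OF aut]]
  have deg_inv: "degree (inv e f) = degree f" for f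
    using deg[of "inv e f"] by (simp add: is_R_aut_inverse[OF aut])
  obtain q where q: "e X1 = [:q:]"
    using deg[of X1] by (auto elim: degree_eq_zeroE)
  note inner = R_hom_inner[OF is_R_aut_hom[OF aut] q]
  obtain g where g: "inv e X1 = [:g:]"
    using deg_inv[of X1] by (auto elim: degree_eq_zeroE)
  have "[:pcompose g q:] = X1"
    using inner[of g] is_R_aut_inverse(1)[OF aut, of X1] by (simp add: g)
  then have "degree (pcompose g q) = 1" by (simp add: X1_def)
  then have q1: "degree q = 1" by (simp add: degree_pcompose)
  have shape: "h = [:coeff h 0, coeff h 1:]" if "degree h = 1" for h :: "'b::comm_ring_1 poly"
    using that by (intro poly_eqI) (auto simp: coeff_pCons coeff_eq_0 split: nat.split)
  have X1: "e X1 = lin (coeff q 1) 0 (coeff q 0)" "coeff q 1 \<noteq> 0"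
    using shape[OF q1] q1 leading_coeff_0_iff[of q] unfolding q lin_def by auto
  obtain p s where ps: "e X2 = [:p, s:]"
    using shape[of "e X2"] deg[of X2] by auto
  obtain g0 g1 where g: "inv e X2 = [:g0, g1:]"
    using shape[of "inv e X2"] deg_inv[of X2] by auto
  have "e [:g0, g1:] = e ([:g0:] + X2 * [:g1:])" by (simp add: X2_def)
  also have "\<dots> = [:pcompose g0 q + pcompose g1 q * p, pcompose g1 q * s:]"
    by (simp add: hom inner ps mult.commute del: mult_pCons_right)
  also have "e [:g0, g1:] = X2"
    using is_R_aut_inverse(1)[OF aut, of X2] by (simp only: g)
  finally have "pcompose g1 q * s = 1"
    by (simp add: X2_def)
  then have "degree (pcompose g1 q) + degree s = 0"
    by (metis degree_1 degree_mult_eq mult_zero_left mult_zero_right zero_neq_one)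
  then obtain c where "s = [:c:]" by (auto elim: degree_eq_zeroE)
  then show ?thesis using that X1 ps by blast
qed

section \<open>Tame automorphisms as words in affine and triangular factors\<close>

definition pprod :: "(('a \<Rightarrow> 'a) \<times> ('a \<Rightarrow> 'a)) list \<Rightarrow> 'a \<Rightarrow> 'a" where
  "pprod xs = foldr (\<lambda>(a, e) \<phi>. a \<circ> e \<circ> \<phi>) xs id"

lemma pprod_simps [simp]:
  "pprod [] = id" "pprod ((a, e) # xs) = a \<circ> e \<circ> pprod xs"
  by (simp_all add: pprod_def)

lemma pprod_append [simp]: "pprod (xs @ ys) = pprod xs \<circ> pprod ys"
  by (induction xs) (auto simp: comp_assoc)

lemma pprod_Tame: "set xs \<subseteq> aff \<times> tri \<Longrightarrow> pprod xs \<in> Tame"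
  by (induction xs) (auto simp: tame_id intro!: tame_comp dest: tri_Tame aff_Tame)

lemma swap_exists:
  "\<exists>\<sigma>\<in>aff. \<sigma> X1 = X2 \<and> \<sigma> X2 = (X1 :: 'a::idom poly poly) \<and> \<sigma> \<circ> \<sigma> = id"
proof -
  obtain \<phi> :: "'a poly poly \<Rightarrow> 'a poly poly" where \<phi>: "is_R_hom \<phi>" "\<phi> X1 = X2" "\<phi> X2 = X1"
    using R_hom_exists by blast
  have "\<phi> \<circ> \<phi> = id"
    by (rule R_hom_eqI) (simp_all add: R_hom_comp R_hom_id \<phi>)
  moreover from this have "bij \<phi>" using o_bij by blast
  then have "is_affine_aut \<phi>"
    by (simp add: is_affine_aut_def is_R_aut_iff \<phi>) (simp add: lin_special tdeg_lin)
  then have "\<phi> \<in> aff"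
    by (intro affI tame_affine) (simp_all add: is_affine_aut_def)
  ultimately show ?thesis using \<phi> by blast
qed

lemma Tame_pprod:
  assumes "\<phi> \<in> Tame"
  shows "\<exists>xs. set xs \<subseteq> aff \<times> tri \<and> \<phi> = pprod xs"
  using assms
proof (induction rule: Tame.induct)
  case tame_id
  show ?case by (rule exI[of _ "[]"]) simp
next
  case (tame_affine \<phi>)
  then have "\<phi> \<in> aff"
    by (intro affI Tame.tame_affine) (simp_all add: is_affine_aut_def)
  \<comment> \<open>\<open>id\<close> lies in both classes, so it fills the missing half of a
    pair.\<close>
  then show ?case by (intro exI[of _ "[(\<phi>, id)]"]) (simp add: tri_aff_id)
next
  case (tame_elem \<phi>)
  show ?case
  proof (cases "\<phi> X1 = X1")
    case True
    then have "\<phi> \<in> tri" using tame_elem by (intro triI Tame.tame_elem) simp_all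
    then show ?thesis by (intro exI[of _ "[(id, \<phi>)]"]) (simp add: tri_aff_id)
  next
    case False
    then have X2: "\<phi> X2 = X2" using tame_elem by (simp add: is_elementary_aut_def)
    obtain \<sigma> :: "'a poly poly \<Rightarrow> 'a poly poly"
      where \<sigma>: "\<sigma> \<in> aff" "\<sigma> X1 = X2" "\<sigma> X2 = X1" "\<sigma> \<circ> \<sigma> = id"
      using swap_exists by blast
    \<comment> \<open>Conjugation by the swap of variables turns fixing x2 into fixing x1.\<close>
    have "\<sigma> \<circ> \<phi> \<circ> \<sigma> \<in> tri"
      using \<sigma> tame_elem X2 by (intro triI tame_comp Tame.tame_elem aff_Tame) simp_all
    moreover have "\<phi> = \<sigma> \<circ> (\<sigma> \<circ> \<phi> \<circ> \<sigma>) \<circ> \<sigma>"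
      using \<sigma>(4) by (metis comp_assoc comp_id id_comp)
    ultimately show ?thesis using \<sigma>(1)
      by (intro exI[of _ "[(\<sigma>, \<sigma> \<circ> \<phi> \<circ> \<sigma>), (\<sigma>, id)]"]) (simp add: tri_aff_id comp_assoc)
  qed
next
  case (tame_comp \<phi> \<psi>)
  then obtain xs ys where "set xs \<subseteq> aff \<times> tri" "\<phi> = pprod xs" "set ys \<subseteq> aff \<times> tri" "\<psi> = pprod ys"
    by blast
  then show ?case by (intro exI[of _ "xs @ ys"]) simp
next
  case (tame_inv \<phi>)
  then obtain xs where "set xs \<subseteq> aff \<times> tri" "\<phi> = pprod xs" by blast
  moreover have "\<exists>ys. set ys \<subseteq> aff \<times> tri \<and> inv (pprod xs) = pprod ys"
    if "set xs \<subseteq> aff \<times> tri" for xs :: "(('a poly poly \<Rightarrow> 'a poly poly) \<times> _) list"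
    using that
  proof (induction xs)
    case Nil
    show ?case by (rule exI[of _ "[]"]) simp
  next
    case (Cons x xs)
    obtain a e where x: "x = (a, e)" by fastforce
    then have ae: "a \<in> aff" "e \<in> tri" "pprod xs \<in> Tame" using Cons.prems pprod_Tame[of xs] by auto
    obtain ys where ys: "set ys \<subseteq> aff \<times> tri" "inv (pprod xs) = pprod ys"
      using Cons by auto
    have "bij a" "bij e" "bij (pprod xs)"
      using ae by (auto intro!: is_R_aut_bij Tame_aut dest: tri_Tame aff_Tame)
    \<comment> \<open>Inversion reverses the order of the two factors, so one pair becomes two
      padded pairs.\<close>
    then have "inv (pprod (x # xs)) = pprod (ys @ [(id, inv e), (inv a, id)])"
      by (simp add: x ys o_inv_distrib bij_comp)
    then show ?case
      using ys ae by (intro exI[of _ "ys @ [(id, inv e), (inv a, id)]"])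
        (simp add: tri_aff_id tri_inv aff_inv)
  qed
  ultimately show ?case by blast
qed

section \<open>Degree growth along alternating words\<close>

lemma R_hom_inner_pcompose:
  assumes "is_R_hom \<phi>"
  shows "\<phi> [:p:] = pcompose (map_poly (\<lambda>c. [:c:]) p) (\<phi> X1)"
proof (induction p)
  case 0
  then show ?case using R_hom_simps(4)[OF assms] by simp
next
  case (pCons c p)
  then show ?case
    unfolding pCons_inner
    by (simp add: R_hom_simps(1-3)[OF assms] map_poly_pCons pcompose_pCons del: mult_pCons_right)
      (simp add: const2_def)
qed

text \<open>Here \<open>\<phi> X1\<close> may involve x2. Thus \<open>p\<close> is first read as a
  polynomial in the outer variable with embedded coefficients, and \<open>\<phi> X1\<close> is
  substituted there.\<close>

lemma degree_R_hom_inner: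
  fixes \<phi> :: "'a::idom poly poly \<Rightarrow> 'a poly poly"
  assumes "is_R_hom \<phi>"
  shows "degree (\<phi> [:p:]) = degree p * degree (\<phi> X1)"
  by (simp add: R_hom_inner_pcompose[OF assms] degree_pcompose degree_map_poly)

text \<open>Ping-pong: the inequality between the two degrees survives a strictly alternating pair of
  factors, while the larger degree grows.\<close>

lemma pprod_degree_step:
  fixes \<psi> :: "'a::idom poly poly \<Rightarrow> 'a poly poly"
  assumes a: "a \<in> aff - tri" and e: "e \<in> tri - aff" and \<psi>: "is_R_hom \<psi>"
    and less: "degree (\<psi> X1) < degree (\<psi> X2)"
  shows "degree (\<psi> (a (e X1))) < degree (\<psi> (a (e X2)))"
    and "degree (\<psi> X2) < degree (\<psi> (a (e X2)))"
proof -
  obtain a1 b1 c1 a2 b2 c2 where aX: "a X1 = lin a1 b1 c1" "a X2 = lin a2 b2 c2"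
    using a by (auto elim: aff_X)
  \<comment> \<open>Otherwise \<open>a X1\<close> would lie in R[x1] and \<open>a\<close> would be
    triangular.\<close>
  have "b1 \<noteq> 0"
    using a triI[of a] by (auto simp: aX degree_lin_eq_0_iff dest: aff_Tame)
  obtain r s t p where eX: "e X1 = lin r 0 s" "r \<noteq> 0" "e X2 = [:p, [:t:]:]"
    using e by (auto elim: tri_X)
  \<comment> \<open>This is where \<open>e\<close> not being affine enters.\<close>
  have deg_p: "degree p > 1"
  proof (rule ccontr)
    assume "\<not> degree p > 1"
    then have "tdeg (e X2) \<le> 1"
      by (auto simp: tdeg_le_iff eX coeff_pCons split: nat.splits)
    moreover have "tdeg (e X1) \<le> 1" by (simp add: eX tdeg_lin)
    ultimately show False using affI[of e] e by (auto dest: tri_Tame)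
  qed
  define \<chi> where "\<chi> = \<psi> \<circ> a"
  have \<chi>: "is_R_hom \<chi>"
    using a \<psi> unfolding \<chi>_def by (auto intro: R_hom_comp is_R_aut_hom Tame_aut dest: aff_Tame)
  note hom\<chi> = R_hom_simps[OF \<chi>]
  define d where "d = degree (\<psi> X2)"
  have "d > 0" using less by (simp add: d_def)
  \<comment> \<open>Composing with \<open>a\<close> levels the degrees: x1 reaches exactly
    \<open>d\<close>, x2 at most \<open>d\<close>. Then \<open>e\<close> keeps x1 at
    \<open>d\<close>, while \<open>p\<close> lifts x2 to \<open>degree p * d\<close>.\<close>
  have \<chi>1: "degree (\<chi> X1) = d"
  proof -
    have "\<chi> X1 = const2 b1 * \<psi> X2 + (const2 a1 * \<psi> X1 + const2 c1)"
      by (simp add: \<chi>_def aX R_hom_simps(5)[OF \<psi>])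
    also have "degree \<dots> = d"
      using less \<open>b1 \<noteq> 0\<close>
      by (subst degree_add_eq_left) (auto simp: d_def intro!: degree_add_less)
    finally show ?thesis .
  qed
  have \<chi>2: "degree (\<chi> X2) \<le> d"
    unfolding \<chi>_def using less
    by (auto simp: aX R_hom_simps(5)[OF \<psi>] d_def intro!: degree_add_le)
  have e1: "degree (\<chi> (e X1)) = d"
    using \<open>d > 0\<close> \<open>r \<noteq> 0\<close> by (simp add: eX hom\<chi> \<chi>1 degree_add_eq_left)
  have "1 * d < degree p * d" using deg_p \<open>d > 0\<close> by (intro mult_strict_right_mono) auto
  then have big: "d < degree (\<chi> [:p:])"
    by (simp add: degree_R_hom_inner[OF \<chi>] \<chi>1)
  have "e X2 = [:p:] + const2 t * X2" unfolding eX(3) by (simp add: const2_def X2_def)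
  then have "\<chi> (e X2) = \<chi> [:p:] + const2 t * \<chi> X2" by (simp add: hom\<chi>)
  also have "degree \<dots> = degree (\<chi> [:p:])"
    using big \<chi>2 by (intro degree_add_eq_left) auto
  finally have e2: "degree (\<chi> (e X2)) > d" using big by simp
  show "degree (\<psi> (a (e X1))) < degree (\<psi> (a (e X2)))"
    and "degree (\<psi> X2) < degree (\<psi> (a (e X2)))"
    using e1 e2 by (simp_all add: \<chi>_def d_def)
qed

text \<open>The outermost pair of the word is absorbed into \<open>\<psi>\<close>, which is why
  \<open>\<psi>\<close> is generalised; each pair adds at least one to the degree.\<close>

lemma pprod_degree:
  fixes \<psi> :: "'a::idom poly poly \<Rightarrow> 'a poly poly"
  assumes "set xs \<subseteq> (aff - tri) \<times> (tri - aff)" "is_R_hom \<psi>"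
    "degree (\<psi> X1) < degree (\<psi> X2)"
  shows "degree (\<psi> X2) + length xs \<le> degree (\<psi> (pprod xs X2))"
  using assms
proof (induction xs arbitrary: \<psi>)
  case (Cons x xs)
  obtain a e where x: "x = (a, e)" by fastforce
  then have ae: "a \<in> aff - tri" "e \<in> tri - aff" using Cons.prems by auto
  have "is_R_hom a" "is_R_hom e"
    using ae by (auto intro: is_R_aut_hom Tame_aut dest: aff_Tame tri_Tame)
  then have hom: "is_R_hom (\<psi> \<circ> a \<circ> e)"
    using Cons.prems(2) by (intro R_hom_comp)
  have "set xs \<subseteq> (aff - tri) \<times> (tri - aff)" using Cons.prems(1) by simp
  moreover have "degree ((\<psi> \<circ> a \<circ> e) X1) < degree ((\<psi> \<circ> a \<circ> e) X2)"
    using pprod_degree_step(1)[OF ae Cons.prems(2,3)] by simp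
  ultimately have "degree ((\<psi> \<circ> a \<circ> e) X2) + length xs \<le> degree ((\<psi> \<circ> a \<circ> e) (pprod xs X2))"
    using Cons.IH hom by blast
  then show ?case
    using pprod_degree_step(2)[OF ae Cons.prems(2,3)] by (simp add: x)
qed simp

lemma pprod_power: "pprod xs ^^ m = pprod (concat (replicate m xs))"
  by (induction m) simp_all

text \<open>A repeated word still alternates, since every pair starts with an affine and ends with a
  triangular factor. The identity starts the ping-pong with degrees 0 and 1.\<close>

lemma pprod_power_degree:
  assumes "set xs \<subseteq> (aff - tri) \<times> (tri - aff)"
  shows "m * length xs < degree ((pprod xs ^^ m) X2)"
proof -
  have "length (concat (replicate m xs)) = m * length xs"
    by (induction m) simp_all
  moreover have "set (concat (replicate m xs)) \<subseteq> (aff - tri) \<times> (tri - aff)"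
    using assms by auto
  ultimately show ?thesis
    unfolding pprod_power using pprod_degree[OF _ R_hom_id, of "concat (replicate m xs)"] by simp
qed

text \<open>In an amalgamated product these are the shapes of a cyclically reduced word; no uniqueness of
  normal forms is needed here.\<close>

definition cyc_reduced :: "('a::idom poly poly \<Rightarrow> 'a poly poly) \<Rightarrow> bool" where
  "cyc_reduced \<phi> \<longleftrightarrow> \<phi> \<in> aff \<or> \<phi> \<in> tri \<or>
     (\<exists>ys. ys \<noteq> [] \<and> set ys \<subseteq> (aff - tri) \<times> (tri - aff) \<and> \<phi> = pprod ys)"

section \<open>Cyclic reduction by conjugation\<close>

lemma conj_comp:
  assumes "bij \<sigma>" "bij \<tau>"
  shows "inv (\<sigma> \<circ> \<tau>) \<circ> \<phi> \<circ> (\<sigma> \<circ> \<tau>) = inv \<tau> \<circ> (inv \<sigma> \<circ> \<phi> \<circ> \<sigma>) \<circ> \<tau>"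
  using assms by (simp add: o_inv_distrib comp_assoc)

text \<open>Cyclic rotation: a prefix of the word moves to its end.\<close>

lemma conj_swap:
  assumes "is_R_aut \<sigma>"
  shows "inv \<sigma> \<circ> (\<sigma> \<circ> \<phi>) \<circ> \<sigma> = \<phi> \<circ> \<sigma>"
  by (simp add: fun_eq_iff is_R_aut_inverse[OF assms])

text \<open>Induction on the length. A pair with a letter in both classes is rotated to an end of
  the word, where it merges with its cyclic neighbour and shortens the word.\<close>

lemma pprod_cyc_reduced:
  assumes "set xs \<subseteq> aff \<times> tri"
  shows "\<exists>\<tau>\<in>Tame. cyc_reduced (inv \<tau> \<circ> pprod xs \<circ> \<tau>)"
  using assms
proof (induction xs rule: length_induct)
  case (1 xs)
  have conj: "\<exists>\<tau>\<in>Tame. cyc_reduced (inv \<tau> \<circ> \<phi> \<circ> \<tau>)"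
    if \<sigma>: "\<sigma> \<in> Tame"
      and ex: "\<exists>\<tau>\<in>Tame. cyc_reduced (inv \<tau> \<circ> (inv \<sigma> \<circ> \<phi> \<circ> \<sigma>) \<circ> \<tau>)"
    for \<sigma> \<phi> :: "'a poly poly \<Rightarrow> 'a poly poly"
  proof -
    obtain \<tau> where \<tau>: "\<tau> \<in> Tame" "cyc_reduced (inv \<tau> \<circ> (inv \<sigma> \<circ> \<phi> \<circ> \<sigma>) \<circ> \<tau>)"
      using ex by blast
    have "bij \<sigma>" "bij \<tau>" using \<sigma> \<tau>(1) by (simp_all add: Tame_aut is_R_aut_bij)
    then show ?thesis
      using \<tau> \<sigma> by (intro bexI[of _ "\<sigma> \<circ> \<tau>"]) (simp_all only: conj_comp tame_comp)
  qed
  have trivial: "\<exists>\<tau>\<in>Tame. cyc_reduced (inv \<tau> \<circ> \<phi> \<circ> \<tau>)" if "cyc_reduced \<phi>"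
    for \<phi> :: "'a poly poly \<Rightarrow> 'a poly poly"
    using that by (intro bexI[of _ id] tame_id) simp
  show ?case
  proof (cases "set xs \<subseteq> (aff - tri) \<times> (tri - aff)")
    case True
    then have "cyc_reduced (pprod xs)"
      unfolding cyc_reduced_def using tri_aff_id(1) by (cases "xs = []") auto
    then show ?thesis by (rule trivial)
  next
    case False
    then obtain a e where ae: "(a, e) \<in> set xs" "a \<in> tri \<or> e \<in> aff"
      using 1(2) by auto
    then obtain us vs where xs: "xs = us @ (a, e) # vs"
      by (meson split_list)
    have mem: "a \<in> aff" "e \<in> tri" "set us \<subseteq> aff \<times> tri" "set vs \<subseteq> aff \<times> tri"
      using 1(2) by (auto simp: xs)
    have tame: "pprod us \<in> Tame" "a \<in> Tame" "e \<in> Tame"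
      using mem by (auto intro: pprod_Tame dest: aff_Tame tri_Tame)
    show ?thesis
    proof (cases "e \<in> aff")
      case True
      \<comment> \<open>With \<open>e\<close> affine, the pair goes to the front and
        \<open>a \<circ> e\<close> joins the affine letter of the next pair. With no other pair, the
        word is affine.\<close>
      have "\<exists>\<tau>\<in>Tame. cyc_reduced (inv \<tau> \<circ> pprod ((a, e) # vs @ us) \<circ> \<tau>)"
      proof (cases "vs @ us")
        case Nil
        then have "cyc_reduced (pprod ((a, e) # vs @ us))"
          using True mem by (simp add: cyc_reduced_def aff_comp)
        then show ?thesis by (rule trivial)
      next
        case (Cons x ws)
        obtain a' e' where x: "x = (a', e')" by fastforce
        have sub: "set (x # ws) \<subseteq> aff \<times> tri" using mem by (simp flip: Cons)
        have "length (x # ws) = length us + length vs" by (simp flip: Cons)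
        then have "length ((a \<circ> e \<circ> a', e') # ws) < length xs" by (simp add: xs)
        moreover have "set ((a \<circ> e \<circ> a', e') # ws) \<subseteq> aff \<times> tri"
          using sub True mem by (simp add: x aff_comp)
        ultimately have "\<exists>\<tau>\<in>Tame. cyc_reduced (inv \<tau> \<circ> pprod ((a \<circ> e \<circ> a', e') # ws) \<circ> \<tau>)"
          using 1(1) by blast
        then show ?thesis by (simp add: Cons x comp_assoc)
      qed
      moreover have "inv (pprod us) \<circ> pprod xs \<circ> pprod us = pprod ((a, e) # vs @ us)"
        using conj_swap[OF Tame_aut[OF tame(1)], of "a \<circ> e \<circ> pprod vs"]
        by (simp add: xs comp_assoc)
      ultimately show ?thesis using conj[OF tame(1), of "pprod xs"] by (simp only:)
    next
      case False
      then have "a \<in> tri" using ae by simp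
      \<comment> \<open>With \<open>a\<close> triangular, the pair goes to the end and
        \<open>a \<circ> e\<close> joins the triangular letter of the preceding pair.\<close>
      have "\<exists>\<tau>\<in>Tame. cyc_reduced (inv \<tau> \<circ> pprod ((vs @ us) @ [(a, e)]) \<circ> \<tau>)"
      proof (cases "vs @ us" rule: rev_cases)
        case Nil
        then have "cyc_reduced (pprod ((vs @ us) @ [(a, e)]))"
          using \<open>a \<in> tri\<close> mem by (simp add: cyc_reduced_def tri_comp)
        then show ?thesis by (rule trivial)
      next
        case (snoc ws x)
        obtain a' e' where x: "x = (a', e')" by fastforce
        have sub: "set (ws @ [x]) \<subseteq> aff \<times> tri" using mem by (simp flip: snoc)
        have "length (ws @ [x]) = length us + length vs" by (simp flip: snoc)
        then have "length (ws @ [(a', e' \<circ> a \<circ> e)]) < length xs" by (simp add: xs)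
        moreover have "set (ws @ [(a', e' \<circ> a \<circ> e)]) \<subseteq> aff \<times> tri"
          using sub \<open>a \<in> tri\<close> mem by (simp add: x tri_comp)
        ultimately have "\<exists>\<tau>\<in>Tame. cyc_reduced (inv \<tau> \<circ> pprod (ws @ [(a', e' \<circ> a \<circ> e)]) \<circ> \<tau>)"
          using 1(1) by blast
        then show ?thesis unfolding snoc by (simp add: x comp_assoc)
      qed
      moreover have "inv (pprod us \<circ> a \<circ> e) \<circ> pprod xs \<circ> (pprod us \<circ> a \<circ> e) = pprod ((vs @ us) @ [(a, e)])"
        using conj_swap[OF Tame_aut, of "pprod us \<circ> a \<circ> e" "pprod vs"] tame
        by (simp add: xs comp_assoc tame_comp)
      moreover have "pprod us \<circ> a \<circ> e \<in> Tame" using tame by (intro tame_comp)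
      ultimately show ?thesis using conj[of "pprod us \<circ> a \<circ> e" "pprod xs"] by (simp only:)
    qed
  qed
qed

section \<open>Locally nilpotent derivations and their exponentials\<close>

lemma R_derivation_simps:
  assumes "is_R_derivation D"
  shows "D (f + g) = D f + D g" "D (f * g) = f * D g + g * D f" "D (const2 r) = 0" "D 0 = 0"
    "D (const2 r * f) = const2 r * D f"
    "D (lin a b c) = const2 a * D X1 + const2 b * D X2"
proof -
  show *: "D (f + g) = D f + D g" "D (f * g) = f * D g + g * D f" "D (const2 r) = 0" for f g r
    using assms by (auto simp: is_R_derivation_def)
  show "D 0 = 0" using *(3)[of 0] by simp
  show "D (const2 r * f) = const2 r * D f" "D (lin a b c) = const2 a * D X1 + const2 b * D X2"
    by (simp_all add: * lin_altdef)
qed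

lemma R_derivation_funpow:
  assumes "is_R_derivation D"
  shows "(D ^^ l) (f + g) = (D ^^ l) f + (D ^^ l) g" "(D ^^ l) 0 = 0"
    "(D ^^ l) (const2 r * f) = const2 r * (D ^^ l) f"
    "(D ^^ l) (\<Sum>i\<in>A. const2 (c i) * F i) = (\<Sum>i\<in>A. const2 (c i) * (D ^^ l) (F i))"
proof -
  show *: "(D ^^ l) (f + g) = (D ^^ l) f + (D ^^ l) g" "(D ^^ l) 0 = 0"
    "(D ^^ l) (const2 r * f) = const2 r * (D ^^ l) f" for f g r
    by (induction l) (simp_all add: R_derivation_simps(1,4,5)[OF assms])
  show "(D ^^ l) (\<Sum>i\<in>A. const2 (c i) * F i) = (\<Sum>i\<in>A. const2 (c i) * (D ^^ l) (F i))"
    by (induction A rule: infinite_finite_induct) (simp_all add: *)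
qed

lemma funpow_eq_0_mono:
  assumes "is_R_derivation D" "(D ^^ l) f = 0" "l \<le> m"
  shows "(D ^^ m) f = 0"
proof -
  have "(D ^^ m) f = (D ^^ (m - l)) ((D ^^ l) f)"
    using assms(3) by (metis comp_apply funpow_add le_add_diff_inverse2)
  then show ?thesis using assms by (simp add: R_derivation_funpow)
qed

text \<open>Replaces the \<open>LEAST\<close> bound by any annihilating exponent; the extra terms
  vanish.\<close>

lemma exp_der_eq:
  assumes "is_R_derivation D" "(D ^^ N) f = 0"
  shows "exp_der D f = (\<Sum>l<N. const2 (nat_inv (fact l)) * (D ^^ l) f)"
proof -
  define L where "L = (LEAST m. (D ^^ m) f = 0)"
  have L: "(D ^^ L) f = 0" using assms(2) unfolding L_def by (rule LeastI)
  have "L \<le> N" using assms(2) unfolding L_def by (rule Least_le)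
  moreover have "(D ^^ l) f = 0" if "L \<le> l" for l
    using funpow_eq_0_mono[OF assms(1) L that] .
  ultimately show ?thesis
    unfolding exp_der_def L_def[symmetric] by (intro sum.mono_neutral_left) auto
qed

lemma nat_inv_1 [simp]: "nat_inv (Suc 0) = 1"
  by (simp add: nat_inv_def)

definition R_submodule :: "'a::comm_ring_1 poly poly set \<Rightarrow> bool" where
  "R_submodule U \<longleftrightarrow> 0 \<in> U \<and> (\<forall>f\<in>U. \<forall>g\<in>U. f + g \<in> U) \<and> (\<forall>r. \<forall>f\<in>U. const2 r * f \<in> U)"

lemma R_submodule_sum:
  "R_submodule U \<Longrightarrow> (\<And>i. i \<in> A \<Longrightarrow> F i \<in> U) \<Longrightarrow> sum F A \<in> U"
  by (induction A rule: infinite_finite_induct) (auto simp: R_submodule_def)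

lemma R_submodule_diff:
  assumes "R_submodule U" "f \<in> U" "g \<in> U"
  shows "f - g \<in> U"
proof -
  have "f + const2 (-1) * g \<in> U" using assms unfolding R_submodule_def by blast
  then show ?thesis by simp
qed

text \<open>The difference \<open>g = exp_der D f - f\<close> is killed by one power of
  \<open>D\<close> fewer than \<open>f\<close>, so an outer induction puts all its iterates in
  \<open>U\<close>. An inner downward induction on the exponent then recovers the iterates of
  \<open>f\<close>.\<close>

lemma exp_der_stable_imp_stable:
  assumes D: "D \<in> LND" and U: "R_submodule U"
    and stable: "\<And>f. f \<in> U \<Longrightarrow> exp_der D f \<in> U" and f: "f \<in> U"
  shows "D f \<in> U"
proof -
  have der: "is_R_derivation D" using D by (simp add: LND_def)
  have "\<forall>j. (D ^^ j) f \<in> U" if "(D ^^ N) f = 0" "f \<in> U" for N f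
    using that
  proof (induction N arbitrary: f)
    case 0
    then show ?case by (simp add: R_derivation_funpow[OF der])
  next
    case (Suc N)
    define c where "c l = (nat_inv (fact l) :: 'a)" for l
    define g where "g = exp_der D f - f"
    have g: "g = (\<Sum>l=1..N. const2 (c l) * (D ^^ l) f)"
      unfolding g_def exp_der_eq[OF der Suc.prems(1)] c_def
      by (simp add: lessThan_Suc_atMost atMost_atLeast0 sum.atLeast_Suc_atMost)
    have Dg: "(D ^^ i) g = (\<Sum>l=1..N. const2 (c l) * (D ^^ (i + l)) f)" for i
      unfolding g R_derivation_funpow(4)[OF der] by (simp add: funpow_add)
    have "g \<in> U" unfolding g_def using Suc.prems U stable by (intro R_submodule_diff)
    \<comment> \<open>Every term of \<open>g\<close> has already been differentiated at least
      once.\<close>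
    moreover have "(D ^^ N) g = 0"
      unfolding Dg by (intro sum.neutral) (auto intro!: funpow_eq_0_mono[OF der Suc.prems(1)])
    ultimately have gU: "(D ^^ i) g \<in> U" for i using Suc.IH by blast
    show ?case
    proof
      fix j
      show "(D ^^ j) f \<in> U"
      proof (induction "Suc N - j" arbitrary: j rule: less_induct)
        case less
        consider "j = 0" | "j > N" | i where "j = Suc i" "j \<le> N"
          by (metis not_less old.nat.exhaust)
        then show ?case
        proof cases
          case 1
          then show ?thesis using Suc.prems by simp
        next
          case 2
          then have "(D ^^ j) f = 0" by (intro funpow_eq_0_mono[OF der Suc.prems(1)]) simp
          then show ?thesis using U by (simp add: R_submodule_def)
        next
          case 3
          \<comment> \<open>The term \<open>l = 1\<close> has coefficient 1 and exponent
            \<open>i + 1 = j\<close>; all others have larger exponents and are covered by the inner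
            hypothesis.\<close>
          have "(D ^^ i) g = (D ^^ j) f + (\<Sum>l=2..N. const2 (c l) * (D ^^ (i + l)) f)"
            unfolding Dg using 3 by (subst sum.atLeast_Suc_atMost) (auto simp: c_def numeral_2_eq_2)
          moreover have "(\<Sum>l=2..N. const2 (c l) * (D ^^ (i + l)) f) \<in> U"
          proof (intro R_submodule_sum[OF U])
            fix l assume "l \<in> {2..N}"
            then have "(D ^^ (i + l)) f \<in> U" using 3 by (intro less) auto
            then show "const2 (c l) * (D ^^ (i + l)) f \<in> U" using U by (simp add: R_submodule_def)
          qed
          ultimately show ?thesis
            using R_submodule_diff[OF U gU[of i], of "\<Sum>l=2..N. const2 (c l) * (D ^^ (i + l)) f"]
            by (simp only: add_diff_cancel_right')
        qed
      qed
    qed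
  qed
  moreover obtain N where "(D ^^ N) f = 0" using D by (auto simp: LND_def)
  ultimately have "(D ^^ 1) f \<in> U" using f by blast
  then show ?thesis by simp
qed

text \<open>Bounding the x2-degree of all iterates of \<open>D\<close> defines a submodule stable
  under \<open>exp_der D\<close>. The bound is a sum over the finitely many relevant iterates of
  \<open>f\<close>, a convenient majorant of their maximum.\<close>

lemma exp_der_power_degree_bounded:
  assumes D: "D \<in> LND"
  shows "\<exists>C. \<forall>m. degree ((exp_der D ^^ m) f) \<le> C"
proof -
  have der: "is_R_derivation D" using D by (simp add: LND_def)
  obtain N where N: "(D ^^ N) f = 0" using D by (auto simp: LND_def)
  define C where "C = (\<Sum>l<N. degree ((D ^^ l) f))"
  define U where "U = {g. \<forall>l. degree ((D ^^ l) g) \<le> C}"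
  have U: "R_submodule U"
    by (auto simp: U_def R_submodule_def R_derivation_funpow[OF der] intro!: degree_add_le)
  have f: "f \<in> U"
    unfolding U_def
  proof safe
    fix l show "degree ((D ^^ l) f) \<le> C"
    proof (cases "l < N")
      case True
      then show ?thesis unfolding C_def by (intro member_le_sum) auto
    next
      case False
      then show ?thesis using funpow_eq_0_mono[OF der N, of l] by simp
    qed
  qed
  have "exp_der D g \<in> U" if "g \<in> U" for g
    unfolding exp_der_def
  proof (intro R_submodule_sum[OF U])
    fix l
    have "(D ^^ j) ((D ^^ l) g) = (D ^^ (j + l)) g" for j by (simp add: funpow_add)
    then have "(D ^^ l) g \<in> U" using that by (simp add: U_def)
    then show "const2 (nat_inv (fact l)) * (D ^^ l) g \<in> U" using U by (simp add: R_submodule_def)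
  qed
  then have "(exp_der D ^^ m) f \<in> U" for m
    by (induction m) (simp_all add: f)
  then have "degree ((D ^^ 0) ((exp_der D ^^ m) f)) \<le> C" for m
    unfolding U_def by blast
  then show ?thesis by auto
qed

lemma funpow_conj:
  assumes "is_R_aut \<tau>"
  shows "(inv \<tau> \<circ> D \<circ> \<tau>) ^^ l = inv \<tau> \<circ> (D ^^ l) \<circ> \<tau>"
  by (induction l) (simp_all add: fun_eq_iff is_R_aut_inverse[OF assms])

lemma
  assumes \<tau>: "is_R_aut \<tau>" and D: "D \<in> LND"
  shows LND_conj: "inv \<tau> \<circ> D \<circ> \<tau> \<in> LND"
    and exp_der_conj: "exp_der (inv \<tau> \<circ> D \<circ> \<tau>) = inv \<tau> \<circ> exp_der D \<circ> \<tau>"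
proof -
  have der: "is_R_derivation D" using D by (simp add: LND_def)
  note hom = R_hom_simps[OF is_R_aut_hom[OF \<tau>]]
  note inv = R_hom_simps[OF is_R_aut_hom[OF is_R_aut_inv[OF \<tau>]]]
  have "is_R_derivation (inv \<tau> \<circ> D \<circ> \<tau>)"
    by (simp add: is_R_aut_inverse[OF \<tau>] is_R_derivation_def hom(1-3) inv(1-4) R_derivation_simps(1-3)[OF der])
  moreover have "\<exists>l. ((inv \<tau> \<circ> D \<circ> \<tau>) ^^ l) f = 0" for f
  proof -
    obtain l where "(D ^^ l) (\<tau> f) = 0" using D by (auto simp: LND_def)
    then show ?thesis by (intro exI[of _ l]) (simp add: funpow_conj[OF \<tau>] inv)
  qed
  ultimately show "inv \<tau> \<circ> D \<circ> \<tau> \<in> LND" by (simp add: LND_def)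
  \<comment> \<open>Hence the \<open>LEAST\<close> bounds in \<open>exp_der\<close> agree for the
    conjugate at \<open>f\<close> and for \<open>D\<close> at \<open>\<tau> f\<close>.\<close>
  have inv0: "inv \<tau> g = 0 \<longleftrightarrow> g = 0" for g
    by (metis \<tau> hom(4) inv(4) is_R_aut_inverse(1))
  have sum: "inv \<tau> (sum F A) = (\<Sum>i\<in>A. inv \<tau> (F i))" for F :: "nat \<Rightarrow> _" and A
    by (induction A rule: infinite_finite_induct) (simp_all add: inv)
  show "exp_der (inv \<tau> \<circ> D \<circ> \<tau>) = inv \<tau> \<circ> exp_der D \<circ> \<tau>"
    by (simp add: fun_eq_iff exp_der_def funpow_conj[OF \<tau>] inv0 sum inv)
qed

lemma Tame_exp_der_conj:
  assumes D: "D \<in> LND" and tame: "exp_der D \<in> Tame"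
  shows "\<exists>\<tau>\<in>Tame. exp_der (inv \<tau> \<circ> D \<circ> \<tau>) \<in> aff \<union> tri"
proof -
  obtain xs where xs: "set xs \<subseteq> aff \<times> tri" "exp_der D = pprod xs"
    using Tame_pprod[OF tame] by blast
  then obtain \<tau> where \<tau>: "\<tau> \<in> Tame" "cyc_reduced (inv \<tau> \<circ> exp_der D \<circ> \<tau>)"
    using pprod_cyc_reduced by metis
  define E where "E = inv \<tau> \<circ> D \<circ> \<tau>"
  have E: "E \<in> LND" "cyc_reduced (exp_der E)"
    using \<tau> LND_conj[OF Tame_aut D] exp_der_conj[OF Tame_aut D] by (simp_all add: E_def)
  have "exp_der E \<noteq> pprod ys" if ys: "ys \<noteq> []" "set ys \<subseteq> (aff - tri) \<times> (tri - aff)" for ys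
  proof
    assume eq: "exp_der E = pprod ys"
    obtain C where "\<And>m. degree ((exp_der E ^^ m) X2) \<le> C"
      using exp_der_power_degree_bounded[OF E(1)] by blast
    \<comment> \<open>The \<open>C\<close>-th power already suffices, since \<open>ys\<close> has
      length at least 1.\<close>
    then have "C * length ys < C"
      using pprod_power_degree[OF ys(2), of C] unfolding eq by (metis order_less_le_trans)
    then show False using ys(1) by (cases ys) auto
  qed
  then have "exp_der E \<in> aff \<union> tri" using E(2) unfolding cyc_reduced_def by blast
  then show ?thesis using \<tau>(1) unfolding E_def by blast
qed


section \<open>From the exponential back to the derivation\<close>

lemma degree_R_derivation_inner:
  assumes der: "is_R_derivation D" and X1: "degree (D X1) = 0"
  shows "degree (D [:p:]) = 0"
proof (induction p)
  case 0
  then show ?case by (simp add: R_derivation_simps(4)[OF der])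
next
  case (pCons c p)
  obtain q q' where "D X1 = [:q:]" "D [:p:] = [:q':]"
    using X1 pCons.IH by (meson degree_eq_zeroE)
  then have "D [:pCons c p:] = X1 * [:q':] + [:p:] * [:q:]"
    unfolding pCons_inner by (simp add: R_derivation_simps(1-3)[OF der] del: mult_pCons_right mult_pCons_left)
  then show ?case by (simp add: X1_def)
qed

text \<open>Each further application of \<open>D\<close> multiplies \<open>lin a 0 b\<close> by
  \<open>a\<close>, so nilpotency makes a power of \<open>a\<close> vanish.\<close>

lemma X1_nilpotent:
  fixes D :: "'a::idom poly poly \<Rightarrow> 'a poly poly"
  assumes D: "D \<in> LND" and X1: "D X1 = lin a 0 b"
  shows "a = 0"
proof -
  have der: "is_R_derivation D" using D by (simp add: LND_def)
  have *: "(D ^^ Suc l) X1 = const2 (a ^ l) * lin a 0 b" for l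
  proof (induction l)
    case (Suc l)
    have "(D ^^ Suc (Suc l)) X1 = D ((D ^^ Suc l) X1)" by simp
    also have "\<dots> = const2 (a ^ l) * (const2 a * lin a 0 b)"
      unfolding Suc R_derivation_simps(5,6)[OF der] X1 by simp
    finally show ?case by (simp add: lin_arith mult_ac)
  qed (simp add: X1)
  obtain l where "(D ^^ l) X1 = 0" using D by (auto simp: LND_def)
  then have "(D ^^ Suc l) X1 = 0" by (simp add: R_derivation_simps(4)[OF der])
  then show ?thesis unfolding * by (auto simp: lin_arith lin_special(4))
qed

text \<open>\<open>D\<close> preserves R[x1], and modulo R[x1] it multiplies x2 by
  \<open>c\<close>.\<close>

lemma X2_nilpotent:
  fixes D :: "'a::idom poly poly \<Rightarrow> 'a poly poly"
  assumes D: "D \<in> LND" and X1: "degree (D X1) = 0" and X2: "D X2 = [:q, [:c:]:]"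
  shows "c = 0"
proof -
  have der: "is_R_derivation D" using D by (simp add: LND_def)
  have *: "\<exists>p. (D ^^ l) X2 = [:p:] + const2 (c ^ l) * X2" for l
  proof (induction l)
    case 0
    then show ?case by (intro exI[of _ 0]) simp
  next
    case (Suc l)
    then obtain p where p: "(D ^^ l) X2 = [:p:] + const2 (c ^ l) * X2" by blast
    obtain p' where p': "D [:p:] = [:p':]"
      using degree_R_derivation_inner[OF der X1] by (meson degree_eq_zeroE)
    have "(D ^^ Suc l) X2 = [:p':] + const2 (c ^ l) * [:q, [:c:]:]"
      by (simp add: p p' X2 R_derivation_simps(1,5)[OF der])
    also have "\<dots> = [:p' + smult (c ^ l) q:] + const2 (c ^ Suc l) * X2"
      by (simp add: const2_def X2_def mult.commute)
    finally show ?case by blast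
  qed
  obtain l where "(D ^^ l) X2 = 0" using D by (auto simp: LND_def)
  then have "c ^ l = 0" using *[of l] by (auto simp: const2_def X2_def)
  then show ?thesis by simp
qed

text \<open>Stability is applied to the submodule of polynomials of total degree at most 1.\<close>

lemma exp_der_aff_imp_affine:
  assumes D: "D \<in> LND" and aff: "exp_der D \<in> aff"
  shows "is_affine_der D"
proof -
  have "R_submodule {f. tdeg f \<le> 1}"
    unfolding R_submodule_def tdeg_le_1_iff by (auto simp: lin_arith intro: lin_special(4)[symmetric])
  then have "D f \<in> {f. tdeg f \<le> 1}" if "tdeg f \<le> 1" for f
    using aff that by (intro exp_der_stable_imp_stable[OF D]) (auto simp: aff_def)
  then show ?thesis
    by (simp add: is_affine_der_def lin_special(1,2) tdeg_lin)
qed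

lemma is_triangularI:
  fixes D :: "'a::idom poly poly \<Rightarrow> 'a poly poly"
  assumes D: "D \<in> LND" and X1: "D X1 = lin a 0 b" and X2: "D X2 = [:q, [:c:]:]"
  shows "is_triangular D"
proof -
  have "a = 0" using D X1 by (rule X1_nilpotent)
  moreover have "c = 0" using X2_nilpotent[OF D _ X2] by (simp add: X1 degree_lin_eq_0_iff)
  ultimately show ?thesis
    using X1 X2 by (auto simp: is_triangular_def lin_special(3))
qed

text \<open>Stability is applied to the submodules R x1 + R and R[x1] + R x2, both invariant by
  \<open>tri_X\<close>. Nilpotency then removes the diagonal coefficients.\<close>

lemma exp_der_tri_imp_triangular:
  assumes D: "D \<in> LND" and tri: "exp_der D \<in> tri"
  shows "is_triangular D"
proof -
  define \<phi> where "\<phi> = exp_der D"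
  note hom = R_hom_simps[OF is_R_aut_hom[OF Tame_aut[OF tri_Tame[OF tri]]], folded \<phi>_def]
  obtain a b c p where X1: "\<phi> X1 = lin a 0 b" and X2: "\<phi> X2 = [:p, [:c:]:]"
    using tri unfolding \<phi>_def by (rule tri_X)
  have deg: "degree (\<phi> f) = degree f" for f
    using tri by (simp add: tri_def \<phi>_def)
  let ?U1 = "{f :: 'a poly poly. \<exists>a b. f = lin a 0 b}"
  have "R_submodule ?U1"
    unfolding R_submodule_def by (auto simp: lin_arith intro: lin_special(4)[symmetric])
  moreover have "\<phi> f \<in> ?U1" if "f \<in> ?U1" for f
    using that by (auto simp: hom(5) X1 lin_arith)
  moreover have "X1 \<in> ?U1" using lin_special(1) by blast
  ultimately have "D X1 \<in> ?U1"
    unfolding \<phi>_def by (rule exp_der_stable_imp_stable[OF D])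
  then obtain a' b' where D1: "D X1 = lin a' 0 b'" by blast
  let ?U2 = "{f :: 'a poly poly. \<exists>q r. f = [:q, [:r:]:]}"
  have "R_submodule ?U2"
    unfolding R_submodule_def
  proof (intro conjI)
    have "0 = [:0, [:0::'a:]:]" by simp
    then show "0 \<in> ?U2" by blast
  qed (auto simp: const2_def)
  moreover have "\<phi> f \<in> ?U2" if "f \<in> ?U2" for f
  proof -
    from that obtain q r where "f = [:q, [:r:]:]" by blast
    then have f: "f = [:q:] + const2 r * X2" by (simp add: const2_def X2_def)
    obtain q' where "\<phi> [:q:] = [:q':]"
      using deg[of "[:q:]"] by (auto elim: degree_eq_zeroE)
    then have "\<phi> f = [:q' + smult r p, [:r * c:]:]"
      unfolding f by (simp add: hom(1-3) X2) (simp add: const2_def)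
    then show ?thesis by blast
  qed
  moreover have "X2 \<in> ?U2"
  proof -
    have "X2 = [:0, [:1::'a:]:]" by (simp add: X2_def one_pCons)
    then show ?thesis by blast
  qed
  ultimately have "D X2 \<in> ?U2"
    unfolding \<phi>_def by (rule exp_der_stable_imp_stable[OF D])
  then obtain q r where "D X2 = [:q, [:r:]:]" by blast
  with is_triangularI[OF D D1] show ?thesis by blast
qed

section \<open>Triangularizing affine derivations\<close>

lemma V_set_unimodular:
  fixes u v :: "'a::idom"
  assumes V: "V_set = {x :: 'a fract. x \<noteq> 0}" and "u \<noteq> 0 \<or> v \<noteq> 0"
  obtains \<alpha> \<beta> s t where "s * \<alpha> + t * \<beta> = 1" "u * \<beta> = v * \<alpha>"
proof (cases "u = 0 \<or> v = 0")
  case True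
  \<comment> \<open>The fraction argument needs both entries nonzero; here (0, 1) or (1, 0) serves
    as (\<open>\<alpha>\<close>, \<open>\<beta>\<close>).\<close>
  then show ?thesis using that[of 0 0 1 1] that[of 1 1 0 0] by auto
next
  case False
  then have "Fract u v \<in> V_set" by (simp add: V Zero_fract_def eq_fract)
  then obtain \<alpha> \<beta> s t where "Fract u v = Fract \<alpha> \<beta>" "\<alpha> \<noteq> 0" "\<beta> \<noteq> 0" "s * \<alpha> + t * \<beta> = 1"
    unfolding V_set_def by blast
  with False show ?thesis using that[of s \<alpha> t \<beta>] by (simp add: eq_fract mult.commute)
qed

lemma affine_LND_eigenform:
  assumes D: "D \<in> LND" and aff: "is_affine_der D"
  shows "\<exists>u v w r. (u \<noteq> 0 \<or> v \<noteq> 0) \<and> D (lin u v w) = const2 r"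
proof -
  have der: "is_R_derivation D" using D by (simp add: LND_def)
  let ?P = "\<lambda>l. \<exists>r. (D ^^ l) X1 = const2 r"
  obtain l where "(D ^^ l) X1 = 0" using D by (auto simp: LND_def)
  then have "?P l" by (intro exI[of _ 0]) simp
  \<comment> \<open>Since x1 is not constant, \<open>l0\<close> is positive; the iterate just before
    it is the wanted form.\<close>
  define l0 where "l0 = (LEAST l. ?P l)"
  have l0: "?P l0" using \<open>?P l\<close> unfolding l0_def by (rule LeastI)
  have "l0 \<noteq> 0"
  proof
    assume "l0 = 0"
    then have "\<exists>r::'a. X1 = const2 r" using l0 by simp
    then show False by (simp add: lin_special)
  qed
  then obtain k where k: "l0 = Suc k" by (auto simp: gr0_conv_Suc)
  then have "k < (LEAST l. ?P l)" by (simp add: l0_def)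
  then have nP: "\<not> ?P k" by (rule not_less_Least)
  obtain a b c a' b' c' where DX: "D X1 = lin a b c" "D X2 = lin a' b' c'"
    using aff unfolding is_affine_der_def tdeg_le_1_iff by blast
  have "\<exists>u v w. (D ^^ l) X1 = lin u v w" for l
  proof (induction l)
    case 0
    then show ?case using lin_special(1) by auto
  next
    case (Suc l)
    then show ?case by (auto simp: R_derivation_simps(6)[OF der] DX lin_arith)
  qed
  then obtain u v w where uvw: "(D ^^ k) X1 = lin u v w" by blast
  with nP have "u \<noteq> 0 \<or> v \<noteq> 0" by (auto simp: lin_special(3))
  moreover have "\<exists>r. D (lin u v w) = const2 r" using l0 by (simp add: k uvw)
  ultimately show ?thesis by blast
qed

text \<open>\<open>\<tau>\<close> sends x1 to a form that \<open>D\<close> maps to a constant, so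
  the conjugate maps x1 to a constant. The conjugate stays affine, which gives the shape required by
  \<open>is_triangularI\<close>.\<close>

lemma affine_LND_conj_triangular:
  fixes D :: "'a::idom poly poly \<Rightarrow> 'a poly poly"
  assumes V: "V_set = {x :: 'a fract. x \<noteq> 0}"
    and D: "D \<in> LND" and aff: "is_affine_der D"
  shows "\<exists>\<tau>\<in>Tame. is_triangular (inv \<tau> \<circ> D \<circ> \<tau>)"
proof -
  have der: "is_R_derivation D" using D by (simp add: LND_def)
  obtain u v w r where uv: "u \<noteq> 0 \<or> v \<noteq> 0" and r: "D (lin u v w) = const2 r"
    using affine_LND_eigenform[OF D aff] by blast
  obtain \<alpha> \<beta> s t where st: "s * \<alpha> + t * \<beta> = 1" and ratio: "u * \<beta> = v * \<alpha>"
    by (rule V_set_unimodular[OF V uv])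
  \<comment> \<open>The unimodular row (\<open>\<alpha>\<close>, \<open>\<beta>\<close>) is
    completed by (\<open>- t\<close>, \<open>s\<close>) to determinant 1.\<close>
  have "\<alpha> * s - \<beta> * (- t) = 1" using st by (simp add: mult.commute)
  then obtain \<tau> where \<tau>: "\<tau> \<in> Tame" "\<tau> X1 = lin \<alpha> \<beta> 0" "\<tau> X2 = lin (- t) s 0"
    using linear_aut_exists by blast
  note aut = Tame_aut[OF \<tau>(1)]
  note inv = R_hom_simps[OF is_R_aut_hom[OF is_R_aut_inv[OF aut]]]
  obtain a b c a' b' c' where DX: "D X1 = lin a b c" "D X2 = lin a' b' c'"
    using aff unfolding is_affine_der_def tdeg_le_1_iff by blast
  have Dlin: "D (lin x y z) = lin (x * a + y * a') (x * b + y * b') (x * c + y * c')" for x y z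
    by (simp add: R_derivation_simps(6)[OF der] DX lin_arith)
  have zero: "u * a + v * a' = 0" "u * b + v * b' = 0"
    using r by (simp_all add: Dlin lin_special(3))
  \<comment> \<open>Relations pass to the proportional row, because in a domain the nonzero one of
    \<open>u\<close> and \<open>v\<close> can be cancelled.\<close>
  have cancel: "\<alpha> * x + \<beta> * y = 0" if "u * x + v * y = 0" for x y
  proof -
    have "u * (\<alpha> * x + \<beta> * y) = \<alpha> * (u * x + v * y)" "v * (\<alpha> * x + \<beta> * y) = \<beta> * (u * x + v * y)"
      using ratio by algebra+
    then show ?thesis using uv that by auto
  qed
  have "D (\<tau> X1) = const2 (\<alpha> * c + \<beta> * c')"
    by (simp add: \<tau> Dlin cancel zero lin_special(3))
  then have E1: "(inv \<tau> \<circ> D \<circ> \<tau>) X1 = lin 0 0 (\<alpha> * c + \<beta> * c')"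
    by (simp add: inv lin_special(3)[symmetric])
  \<comment> \<open>The adjugate matrix again.\<close>
  have inv_X: "inv \<tau> X1 = lin s (- \<beta>) 0" "inv \<tau> X2 = lin t \<alpha> 0"
  proof -
    note hom = R_hom_simps[OF is_R_aut_hom[OF aut]]
    have "\<tau> (lin s (- \<beta>) 0) = X1" "\<tau> (lin t \<alpha> 0) = X2"
      unfolding hom(5) \<tau>(2,3) lin_arith unfolding lin_special(1,2) using st
      by (simp_all add: algebra_simps)
    then show "inv \<tau> X1 = lin s (- \<beta>) 0" "inv \<tau> X2 = lin t \<alpha> 0"
      using is_R_aut_inverse(2)[OF aut] by metis+
  qed
  have "\<exists>x y z. inv \<tau> (lin p q r) = lin x y z" for p q r
    unfolding inv(5) inv_X lin_arith by blast
  then obtain x y z where "(inv \<tau> \<circ> D \<circ> \<tau>) X2 = lin x y z"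
    unfolding o_apply \<tau>(3) Dlin by blast
  then have E2: "(inv \<tau> \<circ> D \<circ> \<tau>) X2 = [:[:z, x:], [:y:]:]" by (simp add: lin_def)
  show ?thesis
    using is_triangularI[OF LND_conj[OF aut D] E1 E2] \<tau>(1) by blast
qed

theorem theorem3p1p1:
  fixes D :: "'a::idom poly poly \<Rightarrow> 'a poly poly"
  assumes "Q_domain TYPE('a)"
    and "D \<in> LND"
    and "exp_der D \<in> Tame"
  shows "(\<exists>\<tau>\<in>Tame. is_triangular (inv \<tau> \<circ> D \<circ> \<tau>) \<or> is_affine_der (inv \<tau> \<circ> D \<circ> \<tau>))
    \<and> (V_set = {x :: 'a fract. x \<noteq> 0} \<longrightarrow> (\<exists>\<tau>\<in>Tame. is_triangular (inv \<tau> \<circ> D \<circ> \<tau>)))"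
proof -
  obtain \<tau> where \<tau>: "\<tau> \<in> Tame" and exp: "exp_der (inv \<tau> \<circ> D \<circ> \<tau>) \<in> aff \<union> tri"
    using Tame_exp_der_conj[OF assms(2,3)] by blast
  define E where "E = inv \<tau> \<circ> D \<circ> \<tau>"
  have E: "E \<in> LND" unfolding E_def by (intro LND_conj Tame_aut \<tau> assms(2))
  have tri_or_aff: "is_triangular E \<or> is_affine_der E"
    using exp exp_der_aff_imp_affine[OF E] exp_der_tri_imp_triangular[OF E] by (auto simp: E_def)
  have "\<exists>\<tau>\<in>Tame. is_triangular (inv \<tau> \<circ> D \<circ> \<tau>)" if V: "V_set = {x :: 'a fract. x \<noteq> 0}"
  proof (cases "is_triangular E")
    case True
    then show ?thesis using \<tau> by (auto simp: E_def)
  next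
    case False
    then obtain \<sigma> where \<sigma>: "\<sigma> \<in> Tame" "is_triangular (inv \<sigma> \<circ> E \<circ> \<sigma>)"
      using affine_LND_conj_triangular[OF V E] tri_or_aff by blast
    \<comment> \<open>The two successive conjugations combine into one by
      \<open>\<tau> \<circ> \<sigma>\<close>.\<close>
    then have "is_triangular (inv (\<tau> \<circ> \<sigma>) \<circ> D \<circ> (\<tau> \<circ> \<sigma>))"
      using \<tau> by (simp only: E_def conj_comp is_R_aut_bij Tame_aut)
    then show ?thesis using \<tau> \<sigma>(1) tame_comp by blast
  qed
  then show ?thesis using \<tau> tri_or_aff unfolding E_def by blast
qed

end
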